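(* The $k$-bounded-lottery rounding scheme is convex for combinatorial public projects with matroid rank sum valuations. That is, for all $n,m$, all $0\le k\le m$, and all matroid rank sum functions $v_1,\dots,v_n:2^{[m]}\to\mathbb{R}_{\ge 0}$, the function $x\mapsto \mathbf{E}_{S\sim r_k(x)}\left[\sum_{i=1}^n v_i(S)\right]$ is concave on $\mathcal{P}_k=\{x\in\mathbb{R}^m:\ \sum_{j=1}^m x_j\le k,\ 0\le x_j\le 1 \text{ for } j=1,\dots,m\}$.
   Context: Matroid rank sum (MRS) function: $v:2^{[m]}\to\mathbb{R}$, where $[m]=\{1,\dots,m\}$, is MRS if there are matroid rank functions $u_1,\dots,u_\kappa$ on ground set $[m]$ and weights $w_1,\dots,w_\kappa\ge 0$ with $v(S)=\sum_{\ell=1}^\kappa w_\ell u_\ell(S)$ for all $S\subseteq[m]$. $k$-bounded-lottery rounding scheme $r_k$: for $x\in\mathcal{P}_k$, $r_k(x)$ is the distribution of the random set $\{j_1,\dots,j_k\}\setminus\{*\}\subseteq[m]$, where $j_1,\dots,j_k$ are independent draws from the distribution on $[m]\cup\{*\}$ giving $j\in[m]$ probability $x_j/k$ and $*$ the remaining probability $1-\frac1k\sum_j x_j$. (Note the set always has size at most $k$. For $k=0$ there are no draws, $\mathcal{P}_0=\{0\}$, and $r_0(0)=\emptyset$ with probability 1.) A randomized rounding scheme is called convex for a class of valuations if, whenever all $v_i$ are in the class, the expected welfare $\mathbf{E}_{S\sim r(x)}[\sum_i v_i(S)]$ is a concave function of $x$. *)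

theory Defs
  imports "HOL-Probability.Probability" "HOL-Analysis.Finite_Function_Topology"
begin

definition matroid :: "'a set \<Rightarrow> 'a set set \<Rightarrow> bool" where
  "matroid E \<I> \<longleftrightarrow>
     finite E \<and> \<I> \<subseteq> Pow E \<and> {} \<in> \<I> \<and>
     (\<forall>A B. B \<in> \<I> \<and> A \<subseteq> B \<longrightarrow> A \<in> \<I>) \<and>
     (\<forall>A B. A \<in> \<I> \<and> B \<in> \<I> \<and> card A < card B \<longrightarrow> (\<exists>e \<in> B - A. insert e A \<in> \<I>))"

definition matroid_rank :: "'a set set \<Rightarrow> 'a set \<Rightarrow> nat" where
  "matroid_rank \<I> S = Max (card ` {A \<in> \<I>. A \<subseteq> S})"

definition matroid_rank_function :: "'a set \<Rightarrow> ('a set \<Rightarrow> real) \<Rightarrow> bool" where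
  "matroid_rank_function E u \<longleftrightarrow>
     (\<exists>\<I>. matroid E \<I> \<and> (\<forall>S \<subseteq> E. u S = real (matroid_rank \<I> S)))"

definition matroid_rank_sum :: "'a set \<Rightarrow> ('a set \<Rightarrow> real) \<Rightarrow> bool" where
  "matroid_rank_sum E v \<longleftrightarrow>
     (\<exists>(\<kappa>::nat) (u :: nat \<Rightarrow> 'a set \<Rightarrow> real) (w :: nat \<Rightarrow> real).
        (\<forall>l \<in> {1..\<kappa>}. matroid_rank_function E (u l) \<and> 0 \<le> w l) \<and>
        (\<forall>S \<subseteq> E. v S = (\<Sum>l = 1..\<kappa>. w l * u l S)))"

text \<open>
  A vector of \<open>\<real>\<^sup>m\<close> is represented by a finitely supported function on the natural numbers that
  vanishes outside \<open>{1..m}\<close>; this keeps \<open>m\<close> an ordinary natural number (possibly \<open>0\<close>), and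
  the type is already an instance of class \<open>real_vector\<close>, as \<open>concave_on\<close> requires.
\<close>

lemma lookup_scaleR:
  "Poly_Mapping.lookup (a *\<^sub>R x) j = a *\<^sub>R Poly_Mapping.lookup x j"
proof -
  have "finite {i. a *\<^sub>R Poly_Mapping.lookup x i \<noteq> 0}"
    by (rule finite_subset[OF _ finite_lookup[of x]]) auto
  then show ?thesis
    by (simp add: scaleR_poly_mapping_def Abs_poly_mapping_inverse)
qed

definition lottery_polytope :: "nat \<Rightarrow> nat \<Rightarrow> (nat \<Rightarrow>\<^sub>0 real) set" where
  "lottery_polytope m k =
     {x. Poly_Mapping.keys x \<subseteq> {1..m} \<and> (\<Sum>j = 1..m. Poly_Mapping.lookup x j) \<le> real k \<and>
         (\<forall>j \<in> {1..m}. 0 \<le> Poly_Mapping.lookup x j \<and> Poly_Mapping.lookup x j \<le> 1)}"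

text \<open>
  The outcome \<open>*\<close> of a draw is \<open>None\<close>. The weights below are a probability mass function for
  \<open>x \<in> lottery_polytope m k\<close>, see \<open>pmf_lottery_draw\<close>; outside the polytope the value is
  irrelevant. For \<open>k = 0\<close>, no draw is made by \<open>bounded_lottery\<close>.
\<close>

definition lottery_weight :: "nat \<Rightarrow> nat \<Rightarrow> (nat \<Rightarrow>\<^sub>0 real) \<Rightarrow> nat option \<Rightarrow> real" where
  "lottery_weight m k x d =
     (case d of
        None \<Rightarrow> 1 - (1 / real k) * (\<Sum>j = 1..m. Poly_Mapping.lookup x j)
      | Some j \<Rightarrow> if j \<in> {1..m} then Poly_Mapping.lookup x j / real k else 0)"

definition lottery_draw :: "nat \<Rightarrow> nat \<Rightarrow> (nat \<Rightarrow>\<^sub>0 real) \<Rightarrow> nat option pmf" where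
  "lottery_draw m k x = embed_pmf (lottery_weight m k x)"

definition bounded_lottery :: "nat \<Rightarrow> nat \<Rightarrow> (nat \<Rightarrow>\<^sub>0 real) \<Rightarrow> nat set pmf" where
  "bounded_lottery m k x =
     map_pmf (\<lambda>d. {j. Some j \<in> d ` {1..k}}) (Pi_pmf {1..k} None (\<lambda>_. lottery_draw m k x))"

definition convex_rounding_scheme ::
  "'x::real_vector set \<Rightarrow> ('x \<Rightarrow> 'a set pmf) \<Rightarrow> ('a set \<Rightarrow> real) set \<Rightarrow> bool" where
  "convex_rounding_scheme P r \<V> \<longleftrightarrow>
     (\<forall>(n::nat) (v :: nat \<Rightarrow> 'a set \<Rightarrow> real). (\<forall>i \<in> {1..n}. v i \<in> \<V>) \<longrightarrow>
        concave_on P (\<lambda>x. measure_pmf.expectation (r x) (\<lambda>S. \<Sum>i = 1..n. v i S)))"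

lemma pmf_lottery_draw:
  assumes x: "x \<in> lottery_polytope m k"
  shows "pmf (lottery_draw m k x) d = lottery_weight m k x d"
  unfolding lottery_draw_def
proof (rule pmf_embed_pmf)
  have sum_le: "(\<Sum>j = 1..m. Poly_Mapping.lookup x j) \<le> real k"
    and nn: "\<And>j. j \<in> {1..m} \<Longrightarrow> 0 \<le> Poly_Mapping.lookup x j"
    using x by (auto simp: lottery_polytope_def)
  show nonneg: "0 \<le> lottery_weight m k x d" for d
    using sum_le nn by (cases "k = 0") (auto simp: lottery_weight_def field_simps split: option.split)
  let ?A = "insert None (Some ` {1..m})"
  have "(\<integral>\<^sup>+ d. ennreal (lottery_weight m k x d) \<partial>count_space UNIV)
      = (\<integral>\<^sup>+ d. ennreal (lottery_weight m k x d) * indicator ?A d \<partial>count_space UNIV)"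
    by (intro nn_integral_cong)
       (auto simp: lottery_weight_def indicator_def image_iff split: option.split)
  also have "\<dots> = (\<integral>\<^sup>+ d. ennreal (lottery_weight m k x d) \<partial>count_space ?A)"
    by (simp add: nn_integral_count_space_indicator)
  also have "\<dots> = (\<Sum>d \<in> ?A. ennreal (lottery_weight m k x d))"
    by (intro nn_integral_count_space_finite) auto
  also have "\<dots> = ennreal (\<Sum>d \<in> ?A. lottery_weight m k x d)"
    using nonneg by (simp add: sum_ennreal del: sum.insert)
  also have "(\<Sum>d \<in> ?A. lottery_weight m k x d) = 1"
  proof -
    have "(\<Sum>d \<in> Some ` {1..m}. lottery_weight m k x d) = (\<Sum>j = 1..m. Poly_Mapping.lookup x j / real k)"
      by (subst sum.reindex) (auto simp: lottery_weight_def)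
    then show ?thesis
      by (subst sum.insert) (auto simp: lottery_weight_def sum_divide_distrib)
  qed
  finally show "(\<integral>\<^sup>+ d. ennreal (lottery_weight m k x d) \<partial>count_space UNIV) = 1"
    by simp
qed

end

theory Submission
  imports Defs
begin

text \<open>
  The expectation of \<open>h\<close> at the set of \<open>k\<close> independent draws from \<open>p\<close> is \<open>(L\<^sub>p ^ k) h {}\<close> for the
  averaging operator \<open>(L\<^sub>p h) S = (\<Sum>a. p a * h (insert a S))\<close>. These operators are linear in \<open>p\<close>,
  commute, and are positive if \<open>p \<ge> 0\<close>. Hence along a segment \<open>p + t \<delta>\<close> the second derivative is
  \<open>k (k - 1) (L\<^bsub>p + t \<delta>\<^esub> ^ (k - 2)) (L\<^sub>\<delta> (L\<^sub>\<delta> h)) {}\<close>, and it suffices that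
  \<open>L\<^sub>\<delta> (L\<^sub>\<delta> h) \<le> 0\<close> when \<open>\<delta>\<close> sums to zero. For a rank function \<open>h\<close>, contracting \<open>S\<close> shows that
  \<open>L\<^sub>\<delta> (L\<^sub>\<delta> h) S\<close> is minus the sum, over the parallel classes \<open>C\<close> of the contraction, of
  \<open>(\<Sum>a\<in>C. \<delta> a)\<^sup>2\<close>.
\<close>

section \<open>The averaging operator\<close>

text \<open>The weights \<open>p\<close> may be negative: the operator is applied both to
  probability vectors and to differences of such vectors.\<close>

definition avg_insert :: "'a set \<Rightarrow> ('a \<Rightarrow> real) \<Rightarrow> ('a set \<Rightarrow> real) \<Rightarrow> 'a set \<Rightarrow> real" where
  "avg_insert D p h S = (\<Sum>a\<in>D. p a * h (insert a S))"

lemma avg_insert_commute: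
  "avg_insert D p (avg_insert D q h) = avg_insert D q (avg_insert D p h)"
proof
  fix S
  have "avg_insert D p (avg_insert D q h) S
      = (\<Sum>a\<in>D. \<Sum>b\<in>D. p a * (q b * h (insert b (insert a S))))"
    by (simp add: avg_insert_def sum_distrib_left)
  also have "\<dots> = (\<Sum>b\<in>D. \<Sum>a\<in>D. p a * (q b * h (insert b (insert a S))))"
    by (rule sum.swap)
  also have "\<dots> = avg_insert D q (avg_insert D p h) S"
    by (simp add: avg_insert_def sum_distrib_left insert_commute mult.left_commute)
  finally show "avg_insert D p (avg_insert D q h) S = avg_insert D q (avg_insert D p h) S" .
qed

lemma avg_insert_funpow_commute:
  "avg_insert D q ((avg_insert D p ^^ k) h) = (avg_insert D p ^^ k) (avg_insert D q h)"
  by (induction k) (simp_all add: avg_insert_commute[of D q])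

lemma avg_insert_funpow_nonpos:
  assumes "\<And>a. a \<in> D \<Longrightarrow> 0 \<le> p a" and "\<And>S. h S \<le> 0"
  shows "(avg_insert D p ^^ k) h S \<le> 0"
proof (induction k arbitrary: S)
  case (Suc k)
  then show ?case
    using assms(1) by (auto simp: avg_insert_def intro!: sum_nonpos mult_nonneg_nonpos)
qed (use assms(2) in simp)

text \<open>Product rule: each of the \<open>k\<close> factors contributes one copy of
  \<open>avg_insert D \<delta>\<close>, and commutation moves it to the innermost place. There it
  merges with \<open>h\<close>, so the lemma applies again to give the second derivative.\<close>

lemma DERIV_avg_insert_funpow:
  "((\<lambda>t. (avg_insert D (\<lambda>a. p a + t * \<delta> a) ^^ k) h S) has_real_derivative
     real k * (avg_insert D (\<lambda>a. p a + t * \<delta> a) ^^ (k - 1)) (avg_insert D \<delta> h) S) (at t)"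
proof (induction k arbitrary: S)
  case (Suc k)
  let ?L = "\<lambda>t. avg_insert D (\<lambda>a. p a + t * \<delta> a)"
  have "((\<lambda>t. (?L t ^^ Suc k) h S) has_real_derivative
      (\<Sum>a\<in>D. \<delta> a * (?L t ^^ k) h (insert a S) +
        (p a + t * \<delta> a) * (real k * (?L t ^^ (k - 1)) (avg_insert D \<delta> h) (insert a S)))) (at t)"
    unfolding funpow.simps o_def avg_insert_def[of D "\<lambda>a. p a + _ * \<delta> a" "(_ ^^ _) h"]
    by (auto intro!: derivative_eq_intros Suc.IH simp: mult.commute mult.left_commute)
  also have "(\<Sum>a\<in>D. \<delta> a * (?L t ^^ k) h (insert a S) +
        (p a + t * \<delta> a) * (real k * (?L t ^^ (k - 1)) (avg_insert D \<delta> h) (insert a S)))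
      = avg_insert D \<delta> ((?L t ^^ k) h) S
        + real k * ?L t ((?L t ^^ (k - 1)) (avg_insert D \<delta> h)) S"
    by (simp add: avg_insert_def sum.distrib sum_distrib_left mult.left_commute)
  also have "\<dots> = real (Suc k) * (?L t ^^ k) (avg_insert D \<delta> h) S"
  \<comment> \<open>Truncated subtraction: \<open>?L t\<close> after its power \<open>k - 1\<close>
    is the power \<open>k\<close> only for positive \<open>k\<close>. For \<open>k = 0\<close> the
    factor \<open>real k\<close> removes the term.\<close>
  proof (cases k)
    case (Suc j)
    have "avg_insert D \<delta> ((?L t ^^ k) h) = (?L t ^^ k) (avg_insert D \<delta> h)"
      by (rule avg_insert_funpow_commute)
    then show ?thesis
      unfolding Suc by (simp add: algebra_simps)
  qed simp
  finally show ?case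
    by simp
qed simp

lemma avg_insert_funpow_concave:
  assumes p: "\<And>a. a \<in> D \<Longrightarrow> 0 \<le> p a" and q: "\<And>a. a \<in> D \<Longrightarrow> 0 \<le> q a"
    and second: "\<And>S. avg_insert D (\<lambda>a. q a - p a) (avg_insert D (\<lambda>a. q a - p a) h) S \<le> 0"
    and t: "0 \<le> t" "t \<le> 1"
  shows "(1 - t) * (avg_insert D p ^^ k) h S + t * (avg_insert D q ^^ k) h S
    \<le> (avg_insert D (\<lambda>a. (1 - t) * p a + t * q a) ^^ k) h S"
proof -
  define \<delta> where "\<delta> = (\<lambda>a. q a - p a)"
  define L where "L = (\<lambda>s. avg_insert D (\<lambda>a. p a + s * \<delta> a))"
  \<comment> \<open>In this form the weights are visibly nonnegative for \<open>s\<close> in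
    \<open>{0..1}\<close>, which makes the operator positive.\<close>
  have L: "L s = avg_insert D (\<lambda>a. (1 - s) * p a + s * q a)" for s
    unfolding L_def \<delta>_def by (rule arg_cong[where f = "avg_insert D"]) (simp add: fun_eq_iff algebra_simps)
  have "concave_on {0..1} (\<lambda>s. (L s ^^ k) h S)"
  proof (rule f''_le0_imp_concave)
    fix s :: real
    assume s: "s \<in> {0..1}"
    show "((\<lambda>s. (L s ^^ k) h S) has_real_derivative
        real k * (L s ^^ (k - 1)) (avg_insert D \<delta> h) S) (at s)"
      unfolding L_def by (rule DERIV_avg_insert_funpow)
    show "((\<lambda>s. real k * (L s ^^ (k - 1)) (avg_insert D \<delta> h) S) has_real_derivative
        real k * (real (k - 1) *
          (L s ^^ (k - 1 - 1)) (avg_insert D \<delta> (avg_insert D \<delta> h)) S)) (at s)"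
      unfolding L_def by (intro DERIV_cmult DERIV_avg_insert_funpow)
    have "(L s ^^ (k - 1 - 1)) (avg_insert D \<delta> (avg_insert D \<delta> h)) S \<le> 0"
      unfolding L using s p q second
      by (intro avg_insert_funpow_nonpos) (auto simp: \<delta>_def)
    then show "real k * (real (k - 1) *
          (L s ^^ (k - 1 - 1)) (avg_insert D \<delta> (avg_insert D \<delta> h)) S) \<le> 0"
      by (intro mult_nonneg_nonpos) auto
  qed simp
  from concave_onD[OF this t, of 0 1] show ?thesis
    by (simp add: L)
qed

text \<open>Conditioning on the draw at one index turns that draw into the outermost operator.
  \<open>T\<close> collects the outcomes already drawn, so it has to vary in the induction.\<close>

lemma expectation_Pi_pmf_eq_avg_insert:
  assumes "finite A" and "finite D" and "set_pmf P \<subseteq> D"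
  shows "measure_pmf.expectation (Pi_pmf A dflt (\<lambda>_. P)) (\<lambda>d. h (T \<union> d ` A))
    = (avg_insert D (pmf P) ^^ card A) h T"
  using assms(1)
proof (induction A arbitrary: T rule: finite_induct)
  case (insert x A)
  have fin: "finite (set_pmf (Pi_pmf A dflt (\<lambda>_. P)))"
    using insert.hyps assms(2,3) finite_subset
    by (auto simp: set_Pi_pmf intro!: finite_PiE_dflt)
  have image: "T \<union> (d(x := y)) ` insert x A = insert y T \<union> d ` A" for d :: "'a \<Rightarrow> 'b" and y
    using insert.hyps by auto
  have "measure_pmf.expectation (Pi_pmf (insert x A) dflt (\<lambda>_. P)) (\<lambda>d. h (T \<union> d ` insert x A))
      = measure_pmf.expectation
          (P \<bind> (\<lambda>y. map_pmf (\<lambda>d. d(x := y)) (Pi_pmf A dflt (\<lambda>_. P)))) (\<lambda>d. h (T \<union> d ` insert x A))"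
    using insert.hyps by (simp add: Pi_pmf_insert' map_pmf_def)
  also have "\<dots> = (\<Sum>y\<in>D. pmf P y *\<^sub>R measure_pmf.expectation
      (map_pmf (\<lambda>d. d(x := y)) (Pi_pmf A dflt (\<lambda>_. P))) (\<lambda>d. h (T \<union> d ` insert x A)))"
    using assms fin by (intro pmf_expectation_bind) auto
  also have "\<dots> = (\<Sum>y\<in>D. pmf P y * measure_pmf.expectation (Pi_pmf A dflt (\<lambda>_. P))
      (\<lambda>d. h (insert y T \<union> d ` A)))"
    by (simp only: integral_map_pmf image real_scaleR_def)
  also have "\<dots> = (avg_insert D (pmf P) ^^ card (insert x A)) h T"
    unfolding insert.IH using insert.hyps by (simp add: avg_insert_def)
  finally show ?case .
qed simp

section \<open>Rank functions\<close>

text \<open>Whitney's local rank axioms, without the normalisation at the empty set.\<close>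

definition local_rank_axioms :: "('a set \<Rightarrow> real) \<Rightarrow> bool" where
  "local_rank_axioms h \<longleftrightarrow>
     (\<forall>S a. h (insert a S) = h S \<or> h (insert a S) = h S + 1) \<and>
     (\<forall>S a b. h (insert a S) = h S \<longrightarrow> h (insert b S) = h S \<longrightarrow> h (insert a (insert b S)) = h S)"

text \<open>Grouping by the value of \<open>f\<close> leaves one square per fibre: that of the total
  of \<open>\<delta>\<close> over the fibre.\<close>

lemma sum_same_class_nonneg:
  fixes \<delta> :: "'a \<Rightarrow> real"
  assumes "finite N"
  shows "0 \<le> (\<Sum>a\<in>N. \<Sum>b\<in>N. if f a = f b then \<delta> a * \<delta> b else 0)"
proof -
  define s where "s = (\<lambda>c. \<Sum>b\<in>{b \<in> N. f b = c}. \<delta> b)"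
  have "(\<Sum>b\<in>N. if f a = f b then \<delta> a * \<delta> b else 0) = \<delta> a * s (f a)" for a
    unfolding s_def sum_distrib_left sum.inter_filter[OF assms]
    by (intro sum.cong) auto
  then have "(\<Sum>a\<in>N. \<Sum>b\<in>N. if f a = f b then \<delta> a * \<delta> b else 0) = (\<Sum>a\<in>N. \<delta> a * s (f a))"
    by simp
  also have "\<dots> = (\<Sum>c\<in>f ` N. \<Sum>a\<in>{a \<in> N. f a = c}. \<delta> a * s (f a))"
    by (rule sum.image_gen[OF assms])
  also have "\<dots> = (\<Sum>c\<in>f ` N. s c * s c)"
    by (intro sum.cong refl) (simp add: s_def sum_distrib_right)
  also have "\<dots> \<ge> 0"
    by (intro sum_nonneg) simp
  finally show ?thesis .
qed

text \<open>Up to terms that depend on at most one of \<open>a\<close> and \<open>b\<close>, which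
  the zero sum of \<open>\<delta>\<close> cancels, \<open>h (insert b (insert a S))\<close> is minus
  the indicator that \<open>a\<close> and \<open>b\<close> are parallel non-loops over
  \<open>S\<close>.\<close>

lemma avg_insert_twice_rank_nonpos:
  assumes h: "local_rank_axioms h" and "finite D" and \<delta>: "(\<Sum>a\<in>D. \<delta> a) = 0"
  shows "avg_insert D \<delta> (avg_insert D \<delta> h) S \<le> 0"
proof -
  have step: "h (insert a T) = h T \<or> h (insert a T) = h T + 1" for a T
    using h by (simp add: local_rank_axioms_def)
  have flat: "h (insert a (insert b T)) = h T" if "h (insert a T) = h T" "h (insert b T) = h T" for a b T
    using h that by (simp add: local_rank_axioms_def)
  \<comment> \<open>In the contraction by \<open>S\<close>, \<open>g\<close> is the rank of a single
    element, \<open>N\<close> the set of non-loops in \<open>D\<close>, and \<open>par\<close>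
    parallelism, an equivalence on \<open>N\<close>. The class map \<open>cl\<close> expresses it as
    equality of values, the form that \<open>sum_same_class_nonneg\<close> takes.\<close>
  define g where "g = (\<lambda>a. h (insert a S) - h S)"
  define N where "N = {a \<in> D. g a = 1}"
  define par where "par = (\<lambda>a b. h (insert a (insert b S)) = h S + 1)"
  define cl where "cl = (\<lambda>a. {b \<in> N. par a b})"
  have par_refl: "par a a" if "a \<in> N" for a
    using that by (simp add: par_def N_def g_def)
  have par_sym: "par a b \<longleftrightarrow> par b a" for a b
    by (simp add: par_def insert_commute)
  have par_trans: "par a c" if "par a b" "par b c" "a \<in> N" "b \<in> N" "c \<in> N" for a b c
  proof -
    \<comment> \<open>after adding \<open>b\<close>, both \<open>a\<close> and \<open>c\<close> are loops\<close>
    have "h (insert a (insert c (insert b S))) = h (insert b S)"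
      using that by (intro flat) (auto simp: par_def N_def g_def insert_commute)
    then have "h (insert b (insert a (insert c S))) = h S + 1"
      using that by (simp add: N_def g_def insert_commute)
    moreover have "h (insert c S) = h S + 1"
      using that by (simp add: N_def g_def)
    \<comment> \<open>\<open>h (insert a (insert c S))\<close> lies between
      \<open>h (insert c S)\<close> and the value after also adding \<open>b\<close>; both equal
      \<open>h S + 1\<close>.\<close>
    ultimately show ?thesis
      using step[of b "insert a (insert c S)"] step[of a "insert c S"] unfolding par_def by linarith
  qed
  have par_iff: "par a b \<longleftrightarrow> cl a = cl b" if "a \<in> N" "b \<in> N" for a b
  proof
    assume "par a b"
    then show "cl a = cl b"
      using that par_trans par_sym unfolding cl_def by blast
  next
    assume "cl a = cl b"
    then show "par a b"
      using that par_refl par_sym unfolding cl_def by blast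
  qed
  have rank2: "h (insert b (insert a S))
      = h S + g a + g b - (if a \<in> N \<and> b \<in> N \<and> cl a = cl b then 1 else 0)"
    if "a \<in> D" "b \<in> D" for a b
  proof (cases "a \<in> N \<and> b \<in> N")
    case True
    then have "h (insert a S) = h S + 1" "g a = 1" "g b = 1"
      by (auto simp: N_def g_def)
    moreover have "h (insert b (insert a S)) = h S + 1 \<longleftrightarrow> cl a = cl b"
      using True par_iff[of b a] unfolding par_def by metis
    ultimately show ?thesis
      using True step[of b "insert a S"] by auto
  next
    case False
    then consider "h (insert a S) = h S" | "h (insert b S) = h S"
      using \<open>a \<in> D\<close> \<open>b \<in> D\<close> step[of a S] step[of b S] unfolding N_def g_def by force
    \<comment> \<open>A loop over \<open>S\<close> does not change the increment of the other
      element: \<open>flat\<close> settles the case of two loops, and otherwise the bounds from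
      adding the two elements in either order meet.\<close>
    then have "h (insert b (insert a S)) + h S = h (insert a S) + h (insert b S)"
      using step[of a S] step[of b S] step[of a "insert b S"] step[of b "insert a S"] flat[of b S a]
      unfolding insert_commute[of a b S] by cases auto
    then show ?thesis
      using False by (auto simp: g_def)
  qed
  have sum_N: "(\<Sum>a\<in>N. f a) = (\<Sum>a\<in>D. if a \<in> N then f a else 0)" for f :: "'a \<Rightarrow> real"
    using \<open>finite D\<close> by (simp add: N_def sum.inter_filter)
  let ?K = "\<lambda>a b. if cl a = cl b then \<delta> a * \<delta> b else 0"
  have "avg_insert D \<delta> (avg_insert D \<delta> h) S
      = (\<Sum>a\<in>D. \<Sum>b\<in>D. \<delta> a * (\<delta> b * h (insert b (insert a S))))"
    by (simp add: avg_insert_def sum_distrib_left)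
  \<comment> \<open>The factors are arranged so that in each of the first two summands one of the
    two sums is the plain sum of \<open>\<delta>\<close>.\<close>
  also have "\<dots> = (\<Sum>a\<in>D. \<Sum>b\<in>D. \<delta> b * (\<delta> a * (h S + g a)) + \<delta> a * (\<delta> b * g b)
      - (if a \<in> N then if b \<in> N then ?K a b else 0 else 0))"
    by (intro sum.cong refl) (simp add: rank2 algebra_simps)
  also have "\<dots> = (\<Sum>a\<in>D. (\<Sum>b\<in>D. \<delta> b) * (\<delta> a * (h S + g a))) + (\<Sum>a\<in>D. \<delta> a) * (\<Sum>b\<in>D. \<delta> b * g b)
      - (\<Sum>a\<in>D. \<Sum>b\<in>D. if a \<in> N then if b \<in> N then ?K a b else 0 else 0)"
    by (simp only: sum.distrib sum_subtractf sum_distrib_left[symmetric] sum_distrib_right[symmetric])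
  also have "\<dots> = - (\<Sum>a\<in>D. \<Sum>b\<in>D. if a \<in> N then if b \<in> N then ?K a b else 0 else 0)"
    by (simp add: \<delta>)
  also have "(\<Sum>a\<in>D. \<Sum>b\<in>D. if a \<in> N then if b \<in> N then ?K a b else 0 else 0)
      = (\<Sum>a\<in>D. if a \<in> N then \<Sum>b\<in>D. if b \<in> N then ?K a b else 0 else 0)"
    by (intro sum.cong refl) simp
  also have "\<dots> = (\<Sum>a\<in>N. \<Sum>b\<in>N. ?K a b)"
    by (simp only: sum_N)
  finally show ?thesis
    using sum_same_class_nonneg[of N cl \<delta>] \<open>finite D\<close> by (simp add: N_def)
qed

section \<open>Matroid rank\<close>

context
  fixes E :: "'a set" and \<I> :: "'a set set"
  assumes matroid: "matroid E \<I>"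
begin

lemma finite_indep_subsets: "finite (card ` {A \<in> \<I>. A \<subseteq> S})"
proof -
  have "finite (Pow E)" and "\<I> \<subseteq> Pow E"
    using matroid by (simp_all add: matroid_def)
  then show ?thesis
    by (intro finite_imageI) (metis (lifting) finite_subset mem_Collect_eq subset_iff)
qed

lemma card_le_matroid_rank: "A \<in> \<I> \<Longrightarrow> A \<subseteq> S \<Longrightarrow> card A \<le> matroid_rank \<I> S"
  unfolding matroid_rank_def by (intro Max_ge finite_indep_subsets) auto

lemma matroid_basis_exists:
  obtains B where "B \<in> \<I>" "B \<subseteq> S" "card B = matroid_rank \<I> S"
proof -
  have "card ` {A \<in> \<I>. A \<subseteq> S} \<noteq> {}"
    using matroid by (auto simp: matroid_def)
  from Max_in[OF finite_indep_subsets this] that show ?thesis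
    unfolding matroid_rank_def by auto
qed

lemma matroid_rank_insert_ge: "matroid_rank \<I> S \<le> matroid_rank \<I> (insert a S)"
proof -
  obtain B where B: "B \<in> \<I>" "B \<subseteq> S" "card B = matroid_rank \<I> S"
    by (rule matroid_basis_exists)
  then show ?thesis
    using card_le_matroid_rank[of B "insert a S"] by auto
qed

text \<open>Deleting \<open>a\<close> from a basis of \<open>insert a S\<close> leaves an
  independent subset of \<open>S\<close> and costs at most one element.\<close>

lemma matroid_rank_insert_le: "matroid_rank \<I> (insert a S) \<le> matroid_rank \<I> S + 1"
proof -
  obtain B where B: "B \<in> \<I>" "B \<subseteq> insert a S" "card B = matroid_rank \<I> (insert a S)"
    by (rule matroid_basis_exists)
  have "B - {a} \<in> \<I>"
    using matroid B(1) unfolding matroid_def by blast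
  then have "card (B - {a}) \<le> matroid_rank \<I> S"
    using B(2) by (intro card_le_matroid_rank) auto
  then show ?thesis
    using B(3) card_Diff1_le[of B a] by (auto simp: card_Diff_singleton_if split: if_splits)
qed

text \<open>If the rank grew, a basis of \<open>S\<close> could be augmented by one element of a
  larger independent set. The result would lie in \<open>insert a S\<close> or
  \<open>insert b S\<close> and exceed the rank of that set.\<close>

lemma matroid_rank_insert2_eq:
  assumes "matroid_rank \<I> (insert a S) = matroid_rank \<I> S"
    and "matroid_rank \<I> (insert b S) = matroid_rank \<I> S"
  shows "matroid_rank \<I> (insert a (insert b S)) = matroid_rank \<I> S"
proof (rule ccontr)
  assume "\<not> ?thesis"
  then have less: "matroid_rank \<I> S < matroid_rank \<I> (insert a (insert b S))"
    using matroid_rank_insert_ge[of S b] matroid_rank_insert_ge[of "insert b S" a] by simp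
  obtain A where A: "A \<in> \<I>" "A \<subseteq> S" "card A = matroid_rank \<I> S"
    by (rule matroid_basis_exists)
  obtain B where B: "B \<in> \<I>" "B \<subseteq> insert a (insert b S)"
    "card B = matroid_rank \<I> (insert a (insert b S))"
    by (rule matroid_basis_exists)
  obtain e where e: "e \<in> B - A" "insert e A \<in> \<I>"
    using matroid A B less unfolding matroid_def by metis
  have "finite A"
    using matroid A(1) unfolding matroid_def by (meson PowD finite_subset subsetD)
  then have card: "card (insert e A) = matroid_rank \<I> S + 1"
    using e A(3) by simp
  have "insert e A \<subseteq> insert a S \<or> insert e A \<subseteq> insert b S"
    using e(1) A(2) B(2) by blast
  then show False
    using card_le_matroid_rank[OF e(2), of "insert a S"] card_le_matroid_rank[OF e(2), of "insert b S"]
      card assms by linarith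
qed

text \<open>Outcomes of draws have type \<open>option\<close>, so the rank is pulled back along
  \<open>Some\<close>; \<open>None\<close> then acts as a loop, as do elements outside the ground
  set.\<close>

lemma local_rank_axioms_matroid_rank:
  "local_rank_axioms (\<lambda>T. real (matroid_rank \<I> {j. Some j \<in> T}))"
proof -
  have ins: "{j. Some j \<in> insert (Some i) T} = insert i {j. Some j \<in> T}" for i :: 'a and T
    by auto
  have none: "{j. Some j \<in> insert None T} = {j. Some j \<in> T}" for T :: "'a option set"
    by auto
  have step: "matroid_rank \<I> (insert a S) = matroid_rank \<I> S \<or>
      matroid_rank \<I> (insert a S) = matroid_rank \<I> S + 1" for a S
    using matroid_rank_insert_ge[of S a] matroid_rank_insert_le[of a S] by linarith
  show ?thesis
    unfolding local_rank_axioms_def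
  proof (intro conjI allI impI)
    fix T :: "'a option set" and a
    show "real (matroid_rank \<I> {j. Some j \<in> insert a T}) = real (matroid_rank \<I> {j. Some j \<in> T}) \<or>
      real (matroid_rank \<I> {j. Some j \<in> insert a T}) = real (matroid_rank \<I> {j. Some j \<in> T}) + 1"
    proof (cases a)
      case None
      then show ?thesis
        by simp
    next
      case (Some i)
      then show ?thesis
        using step[of i "{j. Some j \<in> T}"] by (simp only: ins) linarith
    qed
  next
    fix T :: "'a option set" and a b
    assume "real (matroid_rank \<I> {j. Some j \<in> insert a T}) = real (matroid_rank \<I> {j. Some j \<in> T})"
      and "real (matroid_rank \<I> {j. Some j \<in> insert b T}) = real (matroid_rank \<I> {j. Some j \<in> T})"
    then show "real (matroid_rank \<I> {j. Some j \<in> insert a (insert b T)})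
        = real (matroid_rank \<I> {j. Some j \<in> T})"
      by (cases a; cases b) (simp_all only: ins none of_nat_eq_iff matroid_rank_insert2_eq)
  qed
qed

end

section \<open>The bounded lottery\<close>

lemma convex_lottery_polytope: "convex (lottery_polytope m k)"
  unfolding convex_def
proof (intro ballI allI impI)
  fix x y :: "nat \<Rightarrow>\<^sub>0 real" and u v :: real
  assume x: "x \<in> lottery_polytope m k" and y: "y \<in> lottery_polytope m k"
    and uv: "0 \<le> u" "0 \<le> v" "u + v = 1"
  let ?z = "u *\<^sub>R x + v *\<^sub>R y"
  have z: "Poly_Mapping.lookup ?z j = u * Poly_Mapping.lookup x j + v * Poly_Mapping.lookup y j" for j
    by (simp add: lookup_add lookup_scaleR)
  have "Poly_Mapping.keys ?z \<subseteq> {1..m}"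
  proof
    fix j assume "j \<in> Poly_Mapping.keys ?z"
    then have "j \<in> Poly_Mapping.keys x \<or> j \<in> Poly_Mapping.keys y"
      by (auto simp: in_keys_iff z)
    then show "j \<in> {1..m}"
      using x y by (auto simp: lottery_polytope_def)
  qed
  moreover have "(\<Sum>j = 1..m. Poly_Mapping.lookup ?z j) \<le> real k"
  proof -
    have "(\<Sum>j = 1..m. Poly_Mapping.lookup ?z j)
        = u * (\<Sum>j = 1..m. Poly_Mapping.lookup x j) + v * (\<Sum>j = 1..m. Poly_Mapping.lookup y j)"
      by (simp add: z sum.distrib sum_distrib_left)
    also have "\<dots> \<le> real k"
      using x y uv by (intro convex_bound_le) (auto simp: lottery_polytope_def)
    finally show ?thesis .
  qed
  moreover have "0 \<le> Poly_Mapping.lookup ?z j \<and> Poly_Mapping.lookup ?z j \<le> 1" if "j \<in> {1..m}" for j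
    unfolding z using x y uv that by (auto simp: lottery_polytope_def intro!: convex_bound_le)
  ultimately show "?z \<in> lottery_polytope m k"
    by (simp add: lottery_polytope_def)
qed

context
  fixes m k :: nat and D :: "nat option set"
  defines "D \<equiv> insert None (Some ` {1..m})"
begin

lemma finite_draws: "finite D"
  by (simp add: D_def)

lemma set_pmf_lottery_draw:
  assumes "x \<in> lottery_polytope m k"
  shows "set_pmf (lottery_draw m k x) \<subseteq> D"
proof
  fix a assume "a \<in> set_pmf (lottery_draw m k x)"
  then show "a \<in> D"
    using assms
    by (cases a) (auto simp: set_pmf_iff pmf_lottery_draw D_def lottery_weight_def split: if_splits)
qed

text \<open>The weights are affine in \<open>x\<close>: the constant 1 in the weight of
  \<open>None\<close> splits as \<open>(1 - t) + t\<close>. Division by \<open>k = 0\<close> yields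
  0, so that case fits too.\<close>

lemma lottery_weight_convex_combination:
  assumes "a \<in> D"
  shows "lottery_weight m k ((1 - t) *\<^sub>R x + t *\<^sub>R y) a
    = (1 - t) * lottery_weight m k x a + t * lottery_weight m k y a"
proof (cases a)
  case None
  have "(\<Sum>j = 1..m. Poly_Mapping.lookup ((1 - t) *\<^sub>R x + t *\<^sub>R y) j)
      = (1 - t) * (\<Sum>j = 1..m. Poly_Mapping.lookup x j) + t * (\<Sum>j = 1..m. Poly_Mapping.lookup y j)"
    by (simp add: lookup_add lookup_scaleR sum.distrib sum_distrib_left)
  then show ?thesis
    unfolding None lottery_weight_def option.case by (simp only:) (simp add: algebra_simps diff_divide_distrib add_divide_distrib)
next
  case (Some j)
  then show ?thesis
    by (simp add: lottery_weight_def lookup_add lookup_scaleR add_divide_distrib)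
qed

lemma expectation_bounded_lottery:
  assumes "x \<in> lottery_polytope m k"
  shows "measure_pmf.expectation (bounded_lottery m k x) u
    = (avg_insert D (lottery_weight m k x) ^^ k) (\<lambda>T. u {j. Some j \<in> T}) {}"
proof -
  have "pmf (lottery_draw m k x) = lottery_weight m k x"
    using assms by (simp add: fun_eq_iff pmf_lottery_draw)
  then show ?thesis
    using expectation_Pi_pmf_eq_avg_insert[OF _ finite_draws set_pmf_lottery_draw[OF assms],
        of "{1..k}" None "\<lambda>T. u {j. Some j \<in> T}" "{}"]
    by (simp add: bounded_lottery_def)
qed

lemma finite_set_pmf_bounded_lottery:
  assumes "x \<in> lottery_polytope m k"
  shows "finite (set_pmf (bounded_lottery m k x))"
  using finite_subset[OF set_pmf_lottery_draw[OF assms] finite_draws]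
  by (simp add: bounded_lottery_def set_Pi_pmf finite_PiE_dflt)

text \<open>A rank sum representation describes a valuation only on subsets of
  \<open>{1..m}\<close>; this confines the lottery to those sets.\<close>

lemma set_pmf_bounded_lottery:
  assumes "x \<in> lottery_polytope m k" and "S \<in> set_pmf (bounded_lottery m k x)"
  shows "S \<subseteq> {1..m}"
proof
  fix j assume "j \<in> S"
  with assms(2) obtain i d where "i \<in> {1..k}" "d i = Some j"
    "d \<in> PiE_dflt {1..k} None (\<lambda>_. set_pmf (lottery_draw m k x))"
    by (auto simp: bounded_lottery_def set_Pi_pmf o_def image_iff)
  then have "Some j \<in> D"
    using set_pmf_lottery_draw[OF assms(1)] unfolding PiE_dflt_def by fastforce
  then show "j \<in> {1..m}"
    by (auto simp: D_def)
qed

text \<open>A segment in the polytope becomes a segment of probability vectors on \<open>D\<close>.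
  The difference of its endpoints sums to zero, as the second-order condition requires.\<close>

lemma concave_on_expectation_rank:
  assumes "local_rank_axioms (\<lambda>T. u {j. Some j \<in> T})"
  shows "concave_on (lottery_polytope m k) (\<lambda>x. measure_pmf.expectation (bounded_lottery m k x) u)"
  unfolding concave_on_iff
proof (intro conjI ballI allI impI convex_lottery_polytope)
  fix x y :: "nat \<Rightarrow>\<^sub>0 real" and s t :: real
  assume x: "x \<in> lottery_polytope m k" and y: "y \<in> lottery_polytope m k"
    and st: "0 \<le> s" "0 \<le> t" "s + t = 1"
  have s: "s = 1 - t"
    using st by simp
  let ?w = "lottery_weight m k" and ?h = "\<lambda>T. u {j. Some j \<in> T}"
  have nonneg: "0 \<le> ?w z a" if "z \<in> lottery_polytope m k" for z a
    using that by (metis pmf_lottery_draw pmf_nonneg)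
  have one: "(\<Sum>a\<in>D. ?w z a) = 1" if "z \<in> lottery_polytope m k" for z
    using sum_pmf_eq_1[OF finite_draws set_pmf_lottery_draw[OF that]] that
    by (simp add: pmf_lottery_draw)
  have z: "s *\<^sub>R x + t *\<^sub>R y \<in> lottery_polytope m k"
    using convex_lottery_polytope x y st by (simp add: convex_def)
  have "s * (avg_insert D (?w x) ^^ k) ?h {} + t * (avg_insert D (?w y) ^^ k) ?h {}
      \<le> (avg_insert D (\<lambda>a. s * ?w x a + t * ?w y a) ^^ k) ?h {}"
    unfolding s using nonneg[OF x] nonneg[OF y] st one[OF x] one[OF y] assms finite_draws
    by (intro avg_insert_funpow_concave avg_insert_twice_rank_nonpos) (auto simp: sum_subtractf)
  also have "avg_insert D (\<lambda>a. s * ?w x a + t * ?w y a) = avg_insert D (?w (s *\<^sub>R x + t *\<^sub>R y))"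
    unfolding s by (simp add: avg_insert_def fun_eq_iff lottery_weight_convex_combination)
  finally show "s * measure_pmf.expectation (bounded_lottery m k x) u
      + t * measure_pmf.expectation (bounded_lottery m k y) u
      \<le> measure_pmf.expectation (bounded_lottery m k (s *\<^sub>R x + t *\<^sub>R y)) u"
    by (simp add: expectation_bounded_lottery x y z)
qed

end

section \<open>Matroid rank sums and welfare\<close>

lemma concave_on_sum_fun:
  fixes f :: "'i \<Rightarrow> 'x::real_vector \<Rightarrow> real"
  assumes "convex P" and "\<And>i. i \<in> I \<Longrightarrow> concave_on P (f i)"
  shows "concave_on P (\<lambda>x. \<Sum>i\<in>I. f i x)"
  using assms(2)
proof (induction I rule: infinite_finite_induct)
  case (insert i I)
  then show ?case
    by (simp add: concave_on_add)
qed (simp_all add: assms(1) concave_on_const)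

lemma concave_on_cong:
  assumes "\<And>x. x \<in> P \<Longrightarrow> f x = g x" and "concave_on P f"
  shows "concave_on P g"
  unfolding concave_on_iff
proof (intro conjI ballI allI impI)
  show convex: "convex P"
    using assms(2) by (rule concave_on_imp_convex)
  fix x y and s t :: real
  assume "x \<in> P" "y \<in> P" "0 \<le> s" "0 \<le> t" "s + t = 1"
  moreover from this have "s *\<^sub>R x + t *\<^sub>R y \<in> P"
    using convex by (simp add: convex_def)
  ultimately show "s * g x + t * g y \<le> g (s *\<^sub>R x + t *\<^sub>R y)"
    using assms(2) by (simp add: concave_on_iff flip: assms(1))
qed

lemma concave_on_expectation_matroid_rank_sum:
  assumes "matroid_rank_sum {1..m} v"
  shows "concave_on (lottery_polytope m k) (\<lambda>x. measure_pmf.expectation (bounded_lottery m k x) v)"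
proof -
  obtain \<kappa> :: nat and u w where uw: "\<And>l. l \<in> {1..\<kappa>} \<Longrightarrow> matroid_rank_function {1..m} (u l) \<and> 0 \<le> w l"
    and v: "\<And>S. S \<subseteq> {1..m} \<Longrightarrow> v S = (\<Sum>l = 1..\<kappa>. w l * u l S)"
    using assms unfolding matroid_rank_sum_def by blast
  have "\<forall>l\<in>{1..\<kappa>}. \<exists>\<I>. matroid {1..m} \<I> \<and> (\<forall>S\<subseteq>{1..m}. u l S = real (matroid_rank \<I> S))"
    using uw by (simp add: matroid_rank_function_def)
  then obtain \<I> where \<I>: "\<And>l. l \<in> {1..\<kappa>} \<Longrightarrow> matroid {1..m} (\<I> l)"
    and u: "\<And>l S. l \<in> {1..\<kappa>} \<Longrightarrow> S \<subseteq> {1..m} \<Longrightarrow> u l S = real (matroid_rank (\<I> l) S)"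
    by metis
  \<comment> \<open>Each \<open>u l\<close> is replaced by the rank of its matroid, which satisfies
    the local axioms on all sets, whereas \<open>u l\<close> is known only on subsets of
    \<open>{1..m}\<close>.\<close>
  have v': "v S = (\<Sum>l = 1..\<kappa>. w l * real (matroid_rank (\<I> l) S))" if "S \<subseteq> {1..m}" for S
    using that by (simp add: u v)
  show ?thesis
  proof (rule concave_on_cong)
    show "concave_on (lottery_polytope m k) (\<lambda>x. \<Sum>l = 1..\<kappa>. w l *
        measure_pmf.expectation (bounded_lottery m k x) (\<lambda>S. real (matroid_rank (\<I> l) S)))"
      using uw \<I> by (intro concave_on_sum_fun convex_lottery_polytope concave_on_cmul
          concave_on_expectation_rank local_rank_axioms_matroid_rank) auto
    fix x assume x: "x \<in> lottery_polytope m k"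
    have "measure_pmf.expectation (bounded_lottery m k x) v
        = measure_pmf.expectation (bounded_lottery m k x)
            (\<lambda>S. \<Sum>l = 1..\<kappa>. w l * real (matroid_rank (\<I> l) S))"
      using set_pmf_bounded_lottery[OF x]
      by (intro integral_cong_AE) (auto simp: AE_measure_pmf_iff v')
    then show "(\<Sum>l = 1..\<kappa>. w l *
        measure_pmf.expectation (bounded_lottery m k x) (\<lambda>S. real (matroid_rank (\<I> l) S)))
      = measure_pmf.expectation (bounded_lottery m k x) v"
      using finite_set_pmf_bounded_lottery[OF x] by (simp add: integrable_measure_pmf_finite)
  qed
qed

theorem lemma3p2:
  fixes m k :: nat
  assumes "k \<le> m"
  shows "convex_rounding_scheme (lottery_polytope m k) (bounded_lottery m k)
           {v. matroid_rank_sum {1..m} v \<and> (\<forall>S \<subseteq> {1..m}. 0 \<le> v S)}"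
  unfolding convex_rounding_scheme_def
proof (intro allI impI)
  fix n :: nat and v :: "nat \<Rightarrow> nat set \<Rightarrow> real"
  assume v: "\<forall>i\<in>{1..n}. v i \<in> {v. matroid_rank_sum {1..m} v \<and> (\<forall>S \<subseteq> {1..m}. 0 \<le> v S)}"
  show "concave_on (lottery_polytope m k)
      (\<lambda>x. measure_pmf.expectation (bounded_lottery m k x) (\<lambda>S. \<Sum>i = 1..n. v i S))"
  \<comment> \<open>The lottery has finite support, so the expectation of the welfare is the sum of
    the expectations of the single valuations.\<close>
  proof (rule concave_on_cong)
    show "concave_on (lottery_polytope m k)
        (\<lambda>x. \<Sum>i = 1..n. measure_pmf.expectation (bounded_lottery m k x) (v i))"
      using v by (intro concave_on_sum_fun convex_lottery_polytope
          concave_on_expectation_matroid_rank_sum) auto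
  qed (simp add: integrable_measure_pmf_finite finite_set_pmf_bounded_lottery)
qed

end
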